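(* Let $\mathbb{F}$ be a field and let $A$ and $B$ be associative algebras over $\mathbb{F}$. Let $\Phi:B\to\mathscr{L}(A)/\mathrm{ad}^l(A)$ and $\Phi':B\to\mathscr{L}(A)/\mathrm{ad}^r(A)$ be linear maps, and let $(\varphi,\varphi')$ and $(\psi,\psi')$ be lifts of $(\Phi,\Phi')$ with corresponding extensions $0\to A\to L_{(\varphi,\varphi')}\to B\to0$ and $0\to A\to L_{(\psi,\psi')}\to B\to0$ of associative algebras, respectively. Then $L_{(\varphi,\varphi')}$ is nilpotent if and only if $L_{(\psi,\psi')}$ is nilpotent.
   Context: Associative algebras are $\mathbb{F}$-vector spaces with an associative bilinear multiplication (no unit is assumed). An associative algebra $L$ is nilpotent if $L^u=0$ for some $u\ge0$, where $L^0=L$ and $L^{k+1}=LL^k$ (span of products) for $k\geq 0$. $\mathscr{L}(A)$ is the space of linear maps $A\to A$. For $m\in A$ let $\mathrm{ad}^l_m(n)=mn$ and $\mathrm{ad}^r_m(n)=nm$; $\mathrm{ad}^l(A)=\{\mathrm{ad}^l_m:m\in A\}$ and $\mathrm{ad}^r(A)=\{\mathrm{ad}^r_m:m\in A\}$ are subspaces of $\mathscr{L}(A)$. Let $q:\mathscr{L}(A)\to\mathscr{L}(A)/\mathrm{ad}^l(A)$ and $q':\mathscr{L}(A)\to\mathscr{L}(A)/\mathrm{ad}^r(A)$ be the natural projections of vector spaces. A lift of $(\Phi,\Phi')$ is a pair of linear maps $\varphi,\varphi':B\to\mathscr{L}(A)$ with $q\varphi=\Phi$ and $q'\varphi'=\Phi'$.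 An extension of $A$ by $B$ is a short exact sequence $0\to A\xrightarrow{\sigma}L\xrightarrow{\pi}B\to0$ of associative algebras and homomorphisms. A section is a linear map $T:B\to L$ with $\pi T=\mathrm{id}_B$. A pair $(\varphi,\varphi')$ corresponds to the extension if there is a section $T$ such that $\varphi(i)m=\sigma^{-1}(T(i)\sigma(m))$ and $\varphi'(i)m=\sigma^{-1}(\sigma(m)T(i))$ for all $i\in B$, $m\in A$. *)

theory Defs
  imports Complex_Main "HOL-Library.Function_Algebras" "HOL-Library.Set_Algebras"
begin

text \<open>The type class \<^class>\<open>ring\<close> provides an associative ring without a unit requirement.\<close>

locale assoc_algebra = vector_space scale
  for scale :: "'f::field \<Rightarrow> 'a::ring \<Rightarrow> 'a" +
  assumes scale_mult_left: "scale c x * y = scale c (x * y)"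
    and scale_mult_right: "x * scale c y = scale c (x * y)"

primrec alg_power :: "('f::field \<Rightarrow> 'a::ring \<Rightarrow> 'a) \<Rightarrow> nat \<Rightarrow> 'a set" where
  "alg_power scale 0 = UNIV"
| "alg_power scale (Suc k) = module.span scale {x * y | x y. y \<in> alg_power scale k}"

definition nilpotent_algebra :: "('f::field \<Rightarrow> 'a::ring \<Rightarrow> 'a) \<Rightarrow> bool" where
  "nilpotent_algebra scale \<longleftrightarrow> (\<exists>u. alg_power scale u = {0})"

locale algebra_hom =
  src: assoc_algebra scale1 + tgt: assoc_algebra scale2 + Vector_Spaces.linear scale1 scale2 f
  for scale1 :: "'f::field \<Rightarrow> 'a::ring \<Rightarrow> 'a"
    and scale2 :: "'f \<Rightarrow> 'b::ring \<Rightarrow> 'b"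
    and f :: "'a \<Rightarrow> 'b" +
  assumes hom_mult: "f (x * y) = f x * f y"

locale algebra_extension =
  incl: algebra_hom scaleA scaleL \<sigma> + proj: algebra_hom scaleL scaleB \<pi>
  for scaleA :: "'f::field \<Rightarrow> 'a::ring \<Rightarrow> 'a"
    and scaleL :: "'f \<Rightarrow> 'l::ring \<Rightarrow> 'l"
    and scaleB :: "'f \<Rightarrow> 'b::ring \<Rightarrow> 'b"
    and \<sigma> :: "'a \<Rightarrow> 'l" and \<pi> :: "'l \<Rightarrow> 'b" +
  assumes inj_incl: "inj \<sigma>"
    and exact: "range \<sigma> = {x. \<pi> x = 0}"
    and surj_proj: "surj \<pi>"

definition is_section ::
  "('f::field \<Rightarrow> 'b::ring \<Rightarrow> 'b) \<Rightarrow> ('f \<Rightarrow> 'l::ring \<Rightarrow> 'l) \<Rightarrow> ('l \<Rightarrow> 'b) \<Rightarrow> ('b \<Rightarrow> 'l) \<Rightarrow> bool" where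
  "is_section scaleB scaleL \<pi> T \<longleftrightarrow> Vector_Spaces.linear scaleB scaleL T \<and> \<pi> \<circ> T = id"

definition corresponds ::
  "('f::field \<Rightarrow> 'b::ring \<Rightarrow> 'b) \<Rightarrow> ('f \<Rightarrow> 'l::ring \<Rightarrow> 'l) \<Rightarrow> ('a::ring \<Rightarrow> 'l) \<Rightarrow> ('l \<Rightarrow> 'b) \<Rightarrow>
    ('b \<Rightarrow> 'a \<Rightarrow> 'a) \<Rightarrow> ('b \<Rightarrow> 'a \<Rightarrow> 'a) \<Rightarrow> bool" where
  "corresponds scaleB scaleL \<sigma> \<pi> \<phi> \<phi>' \<longleftrightarrow>
    (\<exists>T. is_section scaleB scaleL \<pi> T \<and>
      (\<forall>i m. \<phi> i m = inv \<sigma> (T i * \<sigma> m) \<and> \<phi>' i m = inv \<sigma> (\<sigma> m * T i)))"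

definition linear_maps :: "('f::field \<Rightarrow> 'a::ring \<Rightarrow> 'a) \<Rightarrow> ('a \<Rightarrow> 'a) set" where
  "linear_maps scale = {f. Vector_Spaces.linear scale scale f}"

definition scale_map :: "('f::field \<Rightarrow> 'a::ring \<Rightarrow> 'a) \<Rightarrow> 'f \<Rightarrow> ('a \<Rightarrow> 'a) \<Rightarrow> 'a \<Rightarrow> 'a" where
  "scale_map scale c f = (\<lambda>x. scale c (f x))"

definition ad_left :: "('a::ring \<Rightarrow> 'a) set" where
  "ad_left = range (\<lambda>m n. m * n)"

definition ad_right :: "('a::ring \<Rightarrow> 'a) set" where
  "ad_right = range (\<lambda>m n. n * m)"

text \<open>
  The quotient of the space of linear maps by a subspace \<open>W\<close> consists of the cosets
  \<^term>\<open>f +o W\<close>, and \<^term>\<open>\<lambda>f. f +o W\<close> is the natural projection. Cosets are added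
  as sets. The summand \<open>W\<close> in \<open>coset_scale\<close> is needed for the scalar \<open>0\<close>, where the
  elementwise multiple of a coset is just the singleton of the zero map.
\<close>

definition map_quotient ::
  "('f::field \<Rightarrow> 'a::ring \<Rightarrow> 'a) \<Rightarrow> ('a \<Rightarrow> 'a) set \<Rightarrow> ('a \<Rightarrow> 'a) set set" where
  "map_quotient scale W = (\<lambda>f. f +o W) ` linear_maps scale"

definition coset_scale ::
  "('f::field \<Rightarrow> 'a::ring \<Rightarrow> 'a) \<Rightarrow> ('a \<Rightarrow> 'a) set \<Rightarrow> 'f \<Rightarrow> ('a \<Rightarrow> 'a) set \<Rightarrow> ('a \<Rightarrow> 'a) set" where
  "coset_scale scale W c X = scale_map scale c ` X + W"

definition linear_to_quotient ::
  "('f::field \<Rightarrow> 'b::ring \<Rightarrow> 'b) \<Rightarrow> ('f \<Rightarrow> 'a::ring \<Rightarrow> 'a) \<Rightarrow> ('a \<Rightarrow> 'a) set \<Rightarrow>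
    ('b \<Rightarrow> ('a \<Rightarrow> 'a) set) \<Rightarrow> bool" where
  "linear_to_quotient scaleB scaleA W \<Phi> \<longleftrightarrow>
    (\<forall>i. \<Phi> i \<in> map_quotient scaleA W) \<and>
    (\<forall>i j. \<Phi> (i + j) = \<Phi> i + \<Phi> j) \<and>
    (\<forall>c i. \<Phi> (scaleB c i) = coset_scale scaleA W c (\<Phi> i))"

definition linear_to_maps ::
  "('f::field \<Rightarrow> 'b::ring \<Rightarrow> 'b) \<Rightarrow> ('f \<Rightarrow> 'a::ring \<Rightarrow> 'a) \<Rightarrow> ('b \<Rightarrow> 'a \<Rightarrow> 'a) \<Rightarrow> bool" where
  "linear_to_maps scaleB scaleA \<phi> \<longleftrightarrow>
    range \<phi> \<subseteq> linear_maps scaleA \<and> Vector_Spaces.linear scaleB (scale_map scaleA) \<phi>"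

definition is_lift ::
  "('f::field \<Rightarrow> 'b::ring \<Rightarrow> 'b) \<Rightarrow> ('f \<Rightarrow> 'a::ring \<Rightarrow> 'a) \<Rightarrow>
    ('b \<Rightarrow> ('a \<Rightarrow> 'a) set) \<Rightarrow> ('b \<Rightarrow> ('a \<Rightarrow> 'a) set) \<Rightarrow>
    ('b \<Rightarrow> 'a \<Rightarrow> 'a) \<Rightarrow> ('b \<Rightarrow> 'a \<Rightarrow> 'a) \<Rightarrow> bool" where
  "is_lift scaleB scaleA \<Phi> \<Phi>' \<phi> \<phi>' \<longleftrightarrow>
    linear_to_maps scaleB scaleA \<phi> \<and> linear_to_maps scaleB scaleA \<phi>' \<and>
    (\<forall>i. \<phi> i +o ad_left = \<Phi> i) \<and> (\<forall>i. \<phi>' i +o ad_right = \<Phi>' i)"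

context assoc_algebra
begin

lemma vector_space_scale_map: "vector_space (scale_map scale)"
  by unfold_locales (auto simp: scale_map_def fun_eq_iff algebra_simps)

lemma subspace_linear_maps: "module.subspace (scale_map scale) (linear_maps scale)"
proof -
  interpret F: vector_space "scale_map scale" by (rule vector_space_scale_map)
  show ?thesis
    unfolding F.subspace_def linear_maps_def Vector_Spaces.linear_iff
    by (auto simp: scale_map_def vector_space_axioms algebra_simps)
qed

lemma subspace_ad_left: "module.subspace (scale_map scale) ad_left"
proof -
  interpret F: vector_space "scale_map scale" by (rule vector_space_scale_map)
  show ?thesis
    unfolding F.subspace_def ad_left_def
  proof (intro conjI allI ballI)
    show "0 \<in> range (\<lambda>m n::'a. m * n)"
      by (rule range_eqI[of _ _ 0]) (simp add: fun_eq_iff)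
  next
    fix x y assume "x \<in> range (\<lambda>m n::'a. m * n)" "y \<in> range (\<lambda>m n::'a. m * n)"
    then obtain a b where "x = (\<lambda>n. a * n)" "y = (\<lambda>n. b * n)" by auto
    then show "x + y \<in> range (\<lambda>m n::'a. m * n)"
      by (intro range_eqI[of _ _ "a + b"]) (simp add: fun_eq_iff distrib_right)
  next
    fix c x assume "x \<in> range (\<lambda>m n::'a. m * n)"
    then obtain a where "x = (\<lambda>n. a * n)" by auto
    then show "scale_map scale c x \<in> range (\<lambda>m n::'a. m * n)"
      by (intro range_eqI[of _ _ "scale c a"]) (simp add: fun_eq_iff scale_map_def scale_mult_left)
  qed
qed

lemma subspace_ad_right: "module.subspace (scale_map scale) ad_right"
proof -
  interpret F: vector_space "scale_map scale" by (rule vector_space_scale_map)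
  show ?thesis
    unfolding F.subspace_def ad_right_def
  proof (intro conjI allI ballI)
    show "0 \<in> range (\<lambda>m n::'a. n * m)"
      by (rule range_eqI[of _ _ 0]) (simp add: fun_eq_iff)
  next
    fix x y assume "x \<in> range (\<lambda>m n::'a. n * m)" "y \<in> range (\<lambda>m n::'a. n * m)"
    then obtain a b where "x = (\<lambda>n. n * a)" "y = (\<lambda>n. n * b)" by auto
    then show "x + y \<in> range (\<lambda>m n::'a. n * m)"
      by (intro range_eqI[of _ _ "a + b"]) (simp add: fun_eq_iff distrib_left)
  next
    fix c x assume "x \<in> range (\<lambda>m n::'a. n * m)"
    then obtain a where "x = (\<lambda>n. n * a)" by auto
    then show "scale_map scale c x \<in> range (\<lambda>m n::'a. n * m)"
      by (intro range_eqI[of _ _ "scale c a"]) (simp add: fun_eq_iff scale_map_def scale_mult_right)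
  qed
qed

lemma coset_add:
  assumes "module.subspace (scale_map scale) W"
  shows "(f +o W) + (g +o W) = (f + g) +o W"
proof -
  interpret F: vector_space "scale_map scale" by (rule vector_space_scale_map)
  have "W + W = W"
    using F.subspace_add[OF assms] F.subspace_0[OF assms]
    by (force simp: set_plus_def)
  then show ?thesis by (simp add: set_plus_rearrange)
qed

lemma coset_scale_coset:
  assumes "module.subspace (scale_map scale) W"
  shows "coset_scale scale W c (f +o W) = scale_map scale c f +o W"
proof -
  interpret F: vector_space "scale_map scale" by (rule vector_space_scale_map)
  have 1: "scale_map scale c (f + w) + v = scale_map scale c f + (scale_map scale c w + v)" for w v
    by (simp add: F.scale_right_distrib add.assoc)
  show ?thesis
  proof (intro equalityI subsetI)
    fix x assume "x \<in> coset_scale scale W c (f +o W)"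
    then obtain w v where "w \<in> W" "v \<in> W" "x = scale_map scale c (f + w) + v"
      by (auto simp: coset_scale_def set_plus_def elt_set_plus_def)
    then show "x \<in> scale_map scale c f +o W"
      unfolding elt_set_plus_def 1
      using F.subspace_add[OF assms F.subspace_scale[OF assms]] by blast
  next
    fix x assume "x \<in> scale_map scale c f +o W"
    then obtain v where v: "v \<in> W" "x = scale_map scale c f + v"
      by (auto simp: elt_set_plus_def)
    have "f \<in> f +o W"
      using F.subspace_0[OF assms] by (force simp: elt_set_plus_def)
    with v show "x \<in> coset_scale scale W c (f +o W)"
      unfolding coset_scale_def by (auto intro: set_plus_intro)
  qed
qed

end

end

theory Submission
  imports Defs
begin

text \<open>
  In an extension \<open>0 \<rightarrow> A \<rightarrow> L \<rightarrow> B \<rightarrow> 0\<close> the algebra \<open>L\<close> acts on the ideal \<open>A\<close> by left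
  multiplication, and \<open>L\<close> is nilpotent iff \<open>B\<close> is nilpotent and this action is nilpotent:
  if \<open>B\<^sup>k = 0\<close> then \<open>L\<^sup>k\<close> lies in \<open>A\<close>, and further factors act by operators on \<open>A\<close>.
  Since \<open>L = T(B) + A\<close>, the operators that occur form the union of the cosets \<open>\<Phi>(i)\<close>, so the
  criterion depends only on \<open>A\<close>, \<open>B\<close> and \<open>\<Phi>\<close>.
\<close>

text \<open>The recursion of \<open>alg_power\<close>, with left factors replaced by operators from
  \<open>S\<close>. Since \<open>S\<close> is a parameter, L does not occur, and different
  extensions can be compared.\<close>

primrec act_power :: "('f::field \<Rightarrow> 'a::ring \<Rightarrow> 'a) \<Rightarrow> ('a \<Rightarrow> 'a) set \<Rightarrow> nat \<Rightarrow> 'a set" where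
  "act_power scale S 0 = UNIV"
| "act_power scale S (Suc k) = module.span scale {f a | f a. f \<in> S \<and> a \<in> act_power scale S k}"

context assoc_algebra
begin

lemma zero_in_alg_power: "0 \<in> alg_power scale k"
  by (cases k) (simp_all add: span_zero)

lemma zero_in_act_power: "0 \<in> act_power scale S k"
  by (cases k) (simp_all add: span_zero)

end

context algebra_extension
begin

lemma proj_incl: "\<pi> (\<sigma> m) = 0"
  using exact by auto

text \<open>Surjectivity of \<open>\<pi>\<close> lifts each left factor from B to L, and a linear
  map sends a span to the span of the image.\<close>

lemma image_proj_alg_power: "\<pi> ` alg_power scaleL k = alg_power scaleB k"
proof (induction k)
  case 0
  show ?case using surj_proj by simp
next
  case (Suc k)
  have "\<pi> ` {x * y | x y. y \<in> alg_power scaleL k} = {x * y | x y. y \<in> \<pi> ` alg_power scaleL k}"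
  proof (intro equalityI subsetI)
    fix z assume "z \<in> {x * y | x y. y \<in> \<pi> ` alg_power scaleL k}"
    then obtain x y where "z = x * \<pi> y" "y \<in> alg_power scaleL k" by auto
    moreover obtain x' where "x = \<pi> x'" using surj_proj by (metis surjD)
    ultimately show "z \<in> \<pi> ` {x * y | x y. y \<in> alg_power scaleL k}"
      by (auto simp: proj.hom_mult[symmetric])
  qed (use proj.hom_mult in blast)
  then show ?case by (simp add: Suc proj.span_image[symmetric])
qed

text \<open>By the two hypotheses, \<open>S\<close> consists exactly of the operators on A induced
  by left multiplications in L. So inside L the operator powers obey the recursion of
  \<open>alg_power\<close>.\<close>

lemma incl_act_power_Suc:
  assumes act: "\<And>x. \<exists>f\<in>S. \<forall>m. x * \<sigma> m = \<sigma> (f m)"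
    and inner: "\<And>f. f \<in> S \<Longrightarrow> \<exists>x. \<forall>m. x * \<sigma> m = \<sigma> (f m)"
  shows "\<sigma> ` act_power scaleA S (Suc n) =
    incl.tgt.span {x * y | x y. y \<in> \<sigma> ` act_power scaleA S n}"
proof -
  have "\<sigma> ` {f a | f a. f \<in> S \<and> a \<in> act_power scaleA S n} =
      {x * y | x y. y \<in> \<sigma> ` act_power scaleA S n}"
  proof (intro equalityI subsetI)
    fix z assume "z \<in> \<sigma> ` {f a | f a. f \<in> S \<and> a \<in> act_power scaleA S n}"
    then obtain f a where "f \<in> S" "a \<in> act_power scaleA S n" "z = \<sigma> (f a)" by auto
    moreover from inner[OF \<open>f \<in> S\<close>] obtain x where "\<forall>m. x * \<sigma> m = \<sigma> (f m)" ..
    ultimately have "z = x * \<sigma> a" by simp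
    with \<open>a \<in> act_power scaleA S n\<close> show "z \<in> {x * y | x y. y \<in> \<sigma> ` act_power scaleA S n}"
      by blast
  next
    fix z assume "z \<in> {x * y | x y. y \<in> \<sigma> ` act_power scaleA S n}"
    then obtain x a where "a \<in> act_power scaleA S n" "z = x * \<sigma> a" by auto
    with act[of x] show "z \<in> \<sigma> ` {f a | f a. f \<in> S \<and> a \<in> act_power scaleA S n}" by auto
  qed
  then show ?thesis by (simp add: incl.span_image[symmetric])
qed

lemma nilpotent_iff_act_power:
  assumes act: "\<And>x. \<exists>f\<in>S. \<forall>m. x * \<sigma> m = \<sigma> (f m)"
    and inner: "\<And>f. f \<in> S \<Longrightarrow> \<exists>x. \<forall>m. x * \<sigma> m = \<sigma> (f m)"
  shows "nilpotent_algebra scaleL \<longleftrightarrow>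
    nilpotent_algebra scaleB \<and> (\<exists>n. act_power scaleA S n = {0})"
proof -
  have step: "\<sigma> ` act_power scaleA S (Suc n) =
      incl.tgt.span {x * y | x y. y \<in> \<sigma> ` act_power scaleA S n}" for n
    using act inner by (rule incl_act_power_Suc)
  show ?thesis
  proof
    assume "nilpotent_algebra scaleL"
    then obtain u where u: "alg_power scaleL u = {0}" by (auto simp: nilpotent_algebra_def)
    \<comment> \<open>Both sides grow by the same left multiplications; the left one starts from the
      image of A, the right one from all of L.\<close>
    have "\<sigma> ` act_power scaleA S n \<subseteq> alg_power scaleL n" for n
    proof (induction n)
      case (Suc n)
      show ?case
        unfolding step alg_power.simps
        by (rule incl.tgt.span_mono) (use Suc in blast)
    qed simp
    from this[of u] have "act_power scaleA S u \<subseteq> {0}"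
      using u inj_incl incl.zero by (auto simp: inj_def)
    then have "act_power scaleA S u = {0}"
      using incl.src.zero_in_act_power by auto
    moreover have "alg_power scaleB u = {0}"
      using image_proj_alg_power[of u] u proj.zero by simp
    ultimately show "nilpotent_algebra scaleB \<and> (\<exists>n. act_power scaleA S n = {0})"
      by (auto simp: nilpotent_algebra_def)
  next
    assume "nilpotent_algebra scaleB \<and> (\<exists>n. act_power scaleA S n = {0})"
    then obtain k n where k: "alg_power scaleB k = {0}" and n: "act_power scaleA S n = {0}"
      by (auto simp: nilpotent_algebra_def)
    \<comment> \<open>For \<open>j = 0\<close>: the power L^k maps onto B^k = 0, so it lies in the
      kernel of \<open>\<pi>\<close>, the image of A. Each further factor acts through
      \<open>S\<close>.\<close>
    have "alg_power scaleL (j + k) \<subseteq> \<sigma> ` act_power scaleA S j" for j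
    proof (induction j)
      case 0
      show ?case using image_proj_alg_power[of k] k exact by auto
    next
      case (Suc j)
      show ?case
        unfolding step alg_power.simps add_Suc
        by (rule incl.tgt.span_mono) (use Suc in blast)
    qed
    from this[of n] have "alg_power scaleL (n + k) = {0}"
      using n incl.zero incl.tgt.zero_in_alg_power by auto
    then show "nilpotent_algebra scaleL" by (auto simp: nilpotent_algebra_def)
  qed
qed

text \<open>Every \<open>x\<close> splits as \<open>T (\<pi> x) + \<sigma> a\<close>. The first
  summand acts on A as \<open>\<phi> (\<pi> x)\<close>, the second as left multiplication by
  \<open>a\<close>. Conversely, \<open>T i + \<sigma> a\<close> induces \<open>\<phi> i\<close> plus
  left multiplication by \<open>a\<close>.\<close>

lemma left_mult_eq_coset_union:
  assumes "corresponds scaleB scaleL \<sigma> \<pi> \<phi> \<phi>'"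
  shows "\<exists>f\<in>(\<Union>i. \<phi> i +o ad_left). \<forall>m. x * \<sigma> m = \<sigma> (f m)"
    and "f \<in> (\<Union>i. \<phi> i +o ad_left) \<Longrightarrow> \<exists>x. \<forall>m. x * \<sigma> m = \<sigma> (f m)"
proof -
  obtain T where T: "\<And>i. \<pi> (T i) = i" and \<phi>: "\<And>i m. \<phi> i m = inv \<sigma> (T i * \<sigma> m)"
    using assms unfolding corresponds_def is_section_def by (metis comp_apply id_apply)
  \<comment> \<open>The kernel of \<open>\<pi>\<close> is an ideal, so \<open>inv \<sigma>\<close>
    is applied only where it really inverts \<open>\<sigma>\<close>.\<close>
  have "T i * \<sigma> m \<in> range \<sigma>" for i m
    by (simp add: exact proj.hom_mult proj_incl)
  then have \<sigma>\<phi>: "\<sigma> (\<phi> i m) = T i * \<sigma> m" for i m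
    by (simp add: \<phi> f_inv_into_f)
  have *: "\<sigma> ((\<phi> i + (\<lambda>n. a * n)) m) = (T i + \<sigma> a) * \<sigma> m" for i a m
    by (simp add: incl.add incl.hom_mult \<sigma>\<phi> distrib_right)
  have "\<pi> (x - T (\<pi> x)) = 0" by (simp add: proj.diff T)
  then obtain a where "x - T (\<pi> x) = \<sigma> a" using exact by blast
  then have "x = T (\<pi> x) + \<sigma> a" by (simp add: algebra_simps)
  with *[of "\<pi> x" a] have "\<forall>m. x * \<sigma> m = \<sigma> ((\<phi> (\<pi> x) + (\<lambda>n. a * n)) m)" by simp
  then show "\<exists>f\<in>(\<Union>i. \<phi> i +o ad_left). \<forall>m. x * \<sigma> m = \<sigma> (f m)"
    unfolding elt_set_plus_def ad_left_def by blast
  show "\<exists>x. \<forall>m. x * \<sigma> m = \<sigma> (f m)" if "f \<in> (\<Union>i. \<phi> i +o ad_left)"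
  proof -
    from that obtain i a where "f = \<phi> i + (\<lambda>n. a * n)"
      by (auto simp: elt_set_plus_def ad_left_def)
    with * show ?thesis by metis
  qed
qed

text \<open>Changing the lift moves each \<open>\<phi> i\<close> only within its coset
  \<open>\<Phi> i\<close>, so the union of the cosets stays the same.\<close>

lemma nilpotent_iff_lift:
  assumes "corresponds scaleB scaleL \<sigma> \<pi> \<phi> \<phi>'" and "is_lift scaleB scaleA \<Phi> \<Phi>' \<phi> \<phi>'"
  shows "nilpotent_algebra scaleL \<longleftrightarrow>
    nilpotent_algebra scaleB \<and> (\<exists>n. act_power scaleA (\<Union>i. \<Phi> i) n = {0})"
proof -
  have "(\<Union>i. \<phi> i +o ad_left) = (\<Union>i. \<Phi> i)"
    using assms(2) by (simp add: is_lift_def)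
  then show ?thesis
    using nilpotent_iff_act_power[OF left_mult_eq_coset_union[OF assms(1)]] by simp
qed

end

theorem corollary4p8:
  fixes scaleA :: "'f::field \<Rightarrow> 'a::ring \<Rightarrow> 'a"
    and scaleB :: "'f \<Rightarrow> 'b::ring \<Rightarrow> 'b"
    and scaleL1 :: "'f \<Rightarrow> 'l1::ring \<Rightarrow> 'l1"
    and scaleL2 :: "'f \<Rightarrow> 'l2::ring \<Rightarrow> 'l2"
    and \<Phi> \<Phi>' :: "'b \<Rightarrow> ('a \<Rightarrow> 'a) set"
    and \<phi> \<phi>' \<psi> \<psi>' :: "'b \<Rightarrow> 'a \<Rightarrow> 'a"
    and \<sigma>1 :: "'a \<Rightarrow> 'l1" and \<pi>1 :: "'l1 \<Rightarrow> 'b"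
    and \<sigma>2 :: "'a \<Rightarrow> 'l2" and \<pi>2 :: "'l2 \<Rightarrow> 'b"
  assumes "assoc_algebra scaleA" and "assoc_algebra scaleB"
    and "linear_to_quotient scaleB scaleA ad_left \<Phi>"
    and "linear_to_quotient scaleB scaleA ad_right \<Phi>'"
    and "is_lift scaleB scaleA \<Phi> \<Phi>' \<phi> \<phi>'"
    and "is_lift scaleB scaleA \<Phi> \<Phi>' \<psi> \<psi>'"
    and "algebra_extension scaleA scaleL1 scaleB \<sigma>1 \<pi>1"
    and "corresponds scaleB scaleL1 \<sigma>1 \<pi>1 \<phi> \<phi>'"
    and "algebra_extension scaleA scaleL2 scaleB \<sigma>2 \<pi>2"
    and "corresponds scaleB scaleL2 \<sigma>2 \<pi>2 \<psi> \<psi>'"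
  shows "nilpotent_algebra scaleL1 \<longleftrightarrow> nilpotent_algebra scaleL2"
  \<comment> \<open>Both extensions yield the same criterion in A, B and
    \<open>\<Phi>\<close>.\<close>
  using algebra_extension.nilpotent_iff_lift[OF assms(7,8,5)]
    algebra_extension.nilpotent_iff_lift[OF assms(9,10,6)]
  by simp

end
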